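(* Let $\mathscr{A}$ be a $C^*$-algebra and let $\mathscr{X}$ be a self-dual Hilbert $\mathscr{A}$-module. Let $\mathscr{Y}$ be an orthogonally complemented submodule of $\mathscr{X}$ and let $P$ be the projection of $\mathscr{X}$ onto $\mathscr{Y}$. Let $B:\mathscr{X}\times\mathscr{X}\to\mathscr{A}$ be a bounded $\mathscr{A}$-sesquilinear form that is positive on $\mathscr{Y}$ (i.e. $B(y,y)\ge0$ for all $y\in\mathscr{Y}$), and let $T$ be the unique adjointable operator on $\mathscr{X}$ with $B(x,y)=\langle T(x),y\rangle$ for all $x,y\in\mathscr{X}$. Put $\mathscr{Y}_0=\{z\in\mathscr{Y}:B(z,y)=0\text{ for all }y\in\mathscr{Y}\}$. Then a necessary condition for the $B$-spline interpolation problem for $\mathscr{Y}$ to have a solution is $$B(x,z)=0\quad\text{for all }x\in\mathscr{X},\ z\in\mathscr{Y}_0.\qquad( * )$$ If $PT\mathscr{Y}$ is closed, then $( * )$ is also sufficient.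
   Context: Hilbert $C^*$-modules are right modules with inner product conjugate-linear in the first and $\mathscr{A}$-linear in the second variable. $\mathscr{X}$ is self-dual if every bounded $\mathscr{A}$-linear map $\mathscr{X}\to\mathscr{A}$ has the form $y\mapsto\langle x,y\rangle$ for some $x\in\mathscr{X}$. A closed submodule $\mathscr{Y}$ is orthogonally complemented if $\mathscr{X}=\mathscr{Y}\oplus\mathscr{Y}^\perp$. A bounded $\mathscr{A}$-sesquilinear form is a bounded map $B$ that is anti-$\mathscr{A}$-linear in the first and $\mathscr{A}$-linear in the second variable ($B(xa,yb)=a^*B(x,y)b$). On a self-dual module every such form is represented by a unique adjointable operator $T$ as in the claim. The $B$-spline interpolation problem has a solution for $\mathscr{Y}$ if for every $x\in\mathscr{X}$ there is $s\in x+\mathscr{Y}$ with $B(s,y)=0$ for all $y\in\mathscr{Y}$. *)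

theory Defs
  imports "HOL-Analysis.Analysis"
begin

class complex_normed_vector = real_normed_vector +
  fixes scaleC :: "complex \<Rightarrow> 'a \<Rightarrow> 'a"  (infixr \<open>*\<^sub>C\<close> 75)
  assumes scaleC_add_right: "c *\<^sub>C (x + y) = c *\<^sub>C x + c *\<^sub>C y"
    and scaleC_add_left: "(c + d) *\<^sub>C x = c *\<^sub>C x + d *\<^sub>C x"
    and scaleC_scaleC: "c *\<^sub>C (d *\<^sub>C x) = (c * d) *\<^sub>C x"
    and scaleC_of_real: "complex_of_real r *\<^sub>C x = r *\<^sub>R x"
    and norm_scaleC: "norm (c *\<^sub>C x) = cmod c * norm x"

class complex_banach = complex_normed_vector + banach

text \<open>No unit is assumed, and the zero algebra is allowed.\<close>

class cstar_algebra = complex_banach + real_normed_algebra +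
  fixes star :: "'a \<Rightarrow> 'a"
  assumes mult_scaleC_left: "(c *\<^sub>C a) * b = c *\<^sub>C (a * b)"
    and mult_scaleC_right: "a * (c *\<^sub>C b) = c *\<^sub>C (a * b)"
    and star_star: "star (star a) = a"
    and star_add: "star (a + b) = star a + star b"
    and star_scaleC: "star (c *\<^sub>C a) = cnj c *\<^sub>C star a"
    and star_mult: "star (a * b) = star b * star a"
    and norm_star_mult_self: "norm (star a * a) = (norm a)\<^sup>2"

text \<open>Equivalent to being self-adjoint with non-negative spectrum; this form needs no unit.\<close>

definition positive_element :: "'a::cstar_algebra \<Rightarrow> bool" where
  "positive_element a \<longleftrightarrow> (\<exists>b. a = star b * b)"

text \<open>
  A Hilbert module lives on a whole type; \<open>rmul x a\<close> is the right action and \<open>ip\<close> the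
  algebra-valued inner product. The norm and topology of the type are those induced by \<open>ip\<close>
  (assumption \<open>norm_eq\<close>), so that completeness is provided by the class \<open>complex_banach\<close>.
\<close>

locale hilbert_cstar_module =
  fixes rmul :: "'x::complex_banach \<Rightarrow> 'a::cstar_algebra \<Rightarrow> 'x"
    and ip :: "'x \<Rightarrow> 'x \<Rightarrow> 'a"
  assumes rmul_add_left: "rmul (x + y) a = rmul x a + rmul y a"
    and rmul_add_right: "rmul x (a + b) = rmul x a + rmul x b"
    and rmul_mult: "rmul x (a * b) = rmul (rmul x a) b"
    and rmul_scaleC_left: "rmul (c *\<^sub>C x) a = c *\<^sub>C rmul x a"
    and rmul_scaleC_right: "rmul x (c *\<^sub>C a) = c *\<^sub>C rmul x a"
    and ip_add_right: "ip x (y + z) = ip x y + ip x z"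
    and ip_scaleC_right: "ip x (c *\<^sub>C y) = c *\<^sub>C ip x y"
    and ip_rmul_right: "ip x (rmul y a) = ip x y * a"
    and ip_star: "star (ip x y) = ip y x"
    and ip_positive: "positive_element (ip x x)"
    and ip_definite: "ip x x = 0 \<Longrightarrow> x = 0"
    and norm_eq: "norm x = sqrt (norm (ip x x))"

definition bounded_functional ::
    "('x::complex_banach \<Rightarrow> 'a::cstar_algebra \<Rightarrow> 'x) \<Rightarrow> ('x \<Rightarrow> 'a) \<Rightarrow> bool" where
  "bounded_functional rmul f \<longleftrightarrow>
     bounded_linear f \<and>
     (\<forall>c x. f (c *\<^sub>C x) = c *\<^sub>C f x) \<and>
     (\<forall>x a. f (rmul x a) = f x * a)"

definition self_dual ::
    "('x::complex_banach \<Rightarrow> 'a::cstar_algebra \<Rightarrow> 'x) \<Rightarrow> ('x \<Rightarrow> 'x \<Rightarrow> 'a) \<Rightarrow> bool" where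
  "self_dual rmul ip \<longleftrightarrow>
     (\<forall>f. bounded_functional rmul f \<longrightarrow> (\<exists>x. \<forall>y. f y = ip x y))"

definition submodule ::
    "('x::complex_banach \<Rightarrow> 'a::cstar_algebra \<Rightarrow> 'x) \<Rightarrow> 'x set \<Rightarrow> bool" where
  "submodule rmul Y \<longleftrightarrow>
     0 \<in> Y \<and>
     (\<forall>x\<in>Y. \<forall>y\<in>Y. x + y \<in> Y) \<and>
     (\<forall>c. \<forall>x\<in>Y. c *\<^sub>C x \<in> Y) \<and>
     (\<forall>x\<in>Y. \<forall>a. rmul x a \<in> Y)"

definition orthogonal_complement ::
    "('x::complex_banach \<Rightarrow> 'x \<Rightarrow> 'a::cstar_algebra) \<Rightarrow> 'x set \<Rightarrow> 'x set" where
  "orthogonal_complement ip Y = {x. \<forall>y\<in>Y. ip x y = 0}"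

definition orthogonally_complemented ::
    "('x::complex_banach \<Rightarrow> 'a::cstar_algebra \<Rightarrow> 'x) \<Rightarrow> ('x \<Rightarrow> 'x \<Rightarrow> 'a) \<Rightarrow> 'x set \<Rightarrow> bool" where
  "orthogonally_complemented rmul ip Y \<longleftrightarrow>
     submodule rmul Y \<and> closed Y \<and>
     (\<forall>x. \<exists>y\<in>Y. \<exists>z\<in>orthogonal_complement ip Y. x = y + z) \<and>
     Y \<inter> orthogonal_complement ip Y = {0}"

definition orthogonal_projection_onto ::
    "('x::complex_banach \<Rightarrow> 'x \<Rightarrow> 'a::cstar_algebra) \<Rightarrow> 'x set \<Rightarrow> ('x \<Rightarrow> 'x) \<Rightarrow> bool" where
  "orthogonal_projection_onto ip Y P \<longleftrightarrow>
     (\<forall>x. P x \<in> Y \<and> x - P x \<in> orthogonal_complement ip Y)"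

text \<open>As usual for Hilbert modules, linearity and boundedness of adjointable operators are
  consequences of the definition.\<close>

definition adjointable ::
    "('x::complex_banach \<Rightarrow> 'x \<Rightarrow> 'a::cstar_algebra) \<Rightarrow> ('x \<Rightarrow> 'x) \<Rightarrow> bool" where
  "adjointable ip T \<longleftrightarrow> (\<exists>S. \<forall>x y. ip (T x) y = ip x (S y))"

definition bounded_sesquilinear_form ::
    "('x::complex_banach \<Rightarrow> 'a::cstar_algebra \<Rightarrow> 'x) \<Rightarrow> ('x \<Rightarrow> 'x \<Rightarrow> 'a) \<Rightarrow> bool" where
  "bounded_sesquilinear_form rmul B \<longleftrightarrow>
     (\<forall>x y z. B (x + y) z = B x z + B y z) \<and>
     (\<forall>x y z. B x (y + z) = B x y + B x z) \<and>
     (\<forall>c x y. B (c *\<^sub>C x) y = cnj c *\<^sub>C B x y) \<and>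
     (\<forall>c x y. B x (c *\<^sub>C y) = c *\<^sub>C B x y) \<and>
     (\<forall>x y a. B (rmul x a) y = star a * B x y) \<and>
     (\<forall>x y b. B x (rmul y b) = B x y * b) \<and>
     (\<exists>K. \<forall>x y. norm (B x y) \<le> K * norm x * norm y)"

definition spline_interpolation_solvable ::
    "('x::complex_banach \<Rightarrow> 'x \<Rightarrow> 'a::cstar_algebra) \<Rightarrow> 'x set \<Rightarrow> bool" where
  "spline_interpolation_solvable B Y \<longleftrightarrow>
     (\<forall>x. \<exists>s\<in>{x + y |y. y \<in> Y}. \<forall>y\<in>Y. B s y = 0)"

definition form_kernel ::
    "('x::complex_banach \<Rightarrow> 'x \<Rightarrow> 'a::cstar_algebra) \<Rightarrow> 'x set \<Rightarrow> 'x set" where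
  "form_kernel B Y = {z \<in> Y. \<forall>y\<in>Y. B z y = 0}"

end

theory Submission
  imports Defs
begin

text \<open>
  On \<open>Y\<close> positivity makes \<open>B\<close> Hermitian, which gives necessity at once. For sufficiency,
  \<open>A = P T P\<close> is self-adjoint with range \<open>P T Y\<close>, and the spline problem for \<open>x\<close> asks for
  \<open>P T x\<close> to lie in that range; the kernel condition says that \<open>P T x\<close> is orthogonal to \<open>ker A\<close>.
  So one needs that a self-adjoint operator with closed range \<open>R\<close> satisfies \<open>(ker A)\<^sup>\<bottom> \<subseteq> R\<close>.
  The uniform boundedness principle on \<open>R\<close> shows that \<open>A\<close> is bounded below on \<open>R\<close>, so \<open>A R\<close>
  is closed. Moreover \<open>A + \<i>t\<close> is onto for \<open>t > 0\<close>: if \<open>x = A y + \<i>t y\<close>, then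
  \<open>A x = A (A y) + \<i>t A y\<close> with \<open>A y\<close> bounded as \<open>t \<rightarrow> 0\<close>, hence \<open>R = A R\<close>
  and \<open>x \<in> R + ker A\<close> for every \<open>x\<close>.
\<close>

section \<open>Uniform boundedness and perturbed surjections in Banach spaces\<close>

text \<open>Baire category in the complete space \<open>R\<close>: the closed sets
  \<open>S n\<close> cover it, so one of them has interior, and linearity turns a ball inside it
  into a uniform bound.\<close>

lemma uniform_boundedness_on_subspace:
  fixes f :: "'i \<Rightarrow> 'x::banach \<Rightarrow> 'b::real_normed_vector"
  assumes lin: "\<And>i. i \<in> I \<Longrightarrow> bounded_linear (f i)"
    and R: "subspace R" "closed R"
    and pointwise: "\<And>x. x \<in> R \<Longrightarrow> \<exists>C. \<forall>i\<in>I. norm (f i x) \<le> C"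
  shows "\<exists>K. \<forall>i\<in>I. \<forall>x\<in>R. norm (f i x) \<le> K * norm x"
proof -
  define S where "S n = {x\<in>R. \<forall>i\<in>I. norm (f i x) \<le> real n}" for n :: nat
  let ?X = "top_of_set R"
  have clS: "closedin ?X (S n)" for n
  proof -
    have "closed {x. norm (f i x) \<le> real n}" if "i \<in> I" for i
      using lin[OF that] by (intro closed_Collect_le continuous_intros)
        (auto simp: linear_continuous_on)
    then have "closed (\<Inter>i\<in>I. {x. norm (f i x) \<le> real n})" by blast
    moreover have "S n = R \<inter> (\<Inter>i\<in>I. {x. norm (f i x) \<le> real n})"
      by (auto simp: S_def)
    ultimately show ?thesis
      by (metis closedin_closed_Int)
  qed
  have UN: "(\<Union>n. S n) = R"
  proof
    show "R \<subseteq> (\<Union>n. S n)"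
    proof
      fix x assume x: "x \<in> R"
      then obtain C where C: "\<forall>i\<in>I. norm (f i x) \<le> C" using pointwise by blast
      obtain n where "C \<le> real n" using real_arch_simple by blast
      with C x have "x \<in> S n" by (force simp: S_def)
      then show "x \<in> (\<Union>n. S n)" by blast
    qed
  qed (auto simp: S_def)
  have "completely_metrizable_space ?X"
    using R(2) completely_metrizable_space_closedin[of euclidean R]
    by (simp add: completely_metrizable_space_euclidean)
  moreover have "?X interior_of \<Union>(range S) = R"
    using UN interior_of_topspace[of ?X] by simp
  moreover have "R \<noteq> {}" using R(1) subspace_0 by blast
  ultimately obtain n where "?X interior_of S n \<noteq> {}"
    using Baire_category_alt[of ?X "range S"] clS by auto
  then obtain x V where V: "openin ?X V" "x \<in> V" "V \<subseteq> S n"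
    by (auto simp: interior_of_def)
  then obtain e where e: "e > 0" "ball x e \<inter> R \<subseteq> V" and xR: "x \<in> R"
    by (metis openin_contains_ball subsetD openin_imp_subset)
  have "norm (f i y) \<le> (4 * real n / e) * norm y" if i: "i \<in> I" and y: "y \<in> R" for i y
  proof (cases "y = 0")
    case True
    then show ?thesis using lin[OF i] by (simp add: linear_simps)
  next
    case False
    interpret bounded_linear "f i" by (rule lin[OF i])
    \<comment> \<open>Rescales \<open>y\<close> to norm \<open>e / 2\<close>, so that
      \<open>x + c *\<^sub>R y\<close> stays in the ball; dividing the bound \<open>2 * n\<close> by
      \<open>c\<close> produces the factor \<open>4 * n / e\<close>.\<close>
    define c where "c = e / (2 * norm y)"
    have c: "c > 0" using e False by (simp add: c_def)
    have "x + c *\<^sub>R y \<in> R" using R(1) xR y by (simp add: subspace_add subspace_scale)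
    moreover have "norm (c *\<^sub>R y) < e" using e False by (simp add: c_def)
    ultimately have "x + c *\<^sub>R y \<in> ball x e \<inter> R" by (simp add: dist_norm)
    then have "x + c *\<^sub>R y \<in> S n" using e(2) V(3) by blast
    moreover have "x \<in> S n" using V by blast
    ultimately have "norm (f i (x + c *\<^sub>R y)) \<le> n" "norm (f i x) \<le> n"
      using i by (auto simp: S_def)
    moreover have "f i (x + c *\<^sub>R y) - f i x = c *\<^sub>R f i y" by (simp add: add scaleR)
    ultimately have "norm (c *\<^sub>R f i y) \<le> 2 * n"
      using norm_triangle_ineq4[of "f i (x + c *\<^sub>R y)" "f i x"] by simp
    then show ?thesis using c False e by (simp add: c_def field_simps)
  qed
  then show ?thesis by blast
qed

text \<open>The equation \<open>x = L y + D y\<close> is a fixed point problem for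
  \<open>y \<mapsto> inv L (x - D y)\<close>; the lower bound on \<open>L\<close> makes this map a
  contraction with factor \<open>k / m\<close>.\<close>

lemma surj_linear_perturbation:
  fixes L D :: "'x::banach \<Rightarrow> 'x"
  assumes L: "linear L" "surj L" "\<And>x. m * norm x \<le> norm (L x)"
    and D: "linear D" "\<And>x. norm (D x) \<le> k * norm x"
    and k: "0 \<le> k" "k < m"
  shows "surj (\<lambda>x. L x + D x)"
proof -
  have "\<exists>y. x = L y + D y" for x
  proof -
    define g where "g y = inv L (x - D y)" for y
    have Lg: "L (g y) = x - D y" for y
      unfolding g_def by (rule surj_f_inv_f[OF L(2)])
    have "dist (g y) (g z) \<le> (k / m) * dist y z" for y z
    proof -
      have "m * norm (g y - g z) \<le> norm (L (g y - g z))" by (rule L)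
      also have "L (g y - g z) = D (z - y)"
        using Lg by (simp add: linear_diff[OF L(1)] linear_diff[OF D(1)])
      also have "norm \<dots> \<le> k * norm (z - y)" by (rule D)
      finally show ?thesis
        using k by (simp add: dist_norm norm_minus_commute field_simps)
    qed
    moreover have "0 \<le> k / m" "k / m < 1" using k by auto
    ultimately obtain y where "g y = y"
      using banach_fix_type[of "k / m" g] by blast
    then have "x = L y + D y" using Lg[of y] by simp
    then show ?thesis ..
  qed
  then show ?thesis by (auto simp: surj_def)
qed

section \<open>The involution and complex scalars\<close>

lemma star_zero: "star (0::'a::cstar_algebra) = 0"
  using star_add[of "0::'a" 0] by simp

lemma star_minus: "star (- a) = - star (a::'a::cstar_algebra)"
  using star_add[of a "- a"] by (simp add: star_zero eq_neg_iff_add_eq_0 add.commute)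

text \<open>The C*-identity and submultiplicativity give one inequality; applied to
  \<open>star a\<close> it gives the other.\<close>

lemma norm_star: "norm (star a) = norm (a::'a::cstar_algebra)"
proof -
  have *: "norm b \<le> norm (star b)" for b :: 'a
  proof (cases "b = 0")
    case False
    have "norm b * norm b \<le> norm (star b) * norm b"
      using norm_star_mult_self[of b] norm_mult_ineq[of "star b" b]
      by (simp add: power2_eq_square)
    with False show ?thesis by simp
  qed simp
  show ?thesis using *[of a] *[of "star a"] by (simp add: star_star)
qed

lemma star_positive_element: "positive_element a \<Longrightarrow> star a = a"
  by (auto simp: positive_element_def star_mult star_star)

lemma scaleR_eq_scaleC: "r *\<^sub>R x = complex_of_real r *\<^sub>C (x::'x::complex_normed_vector)"
  by (simp add: scaleC_of_real)

lemma scaleC_one: "1 *\<^sub>C x = (x::'x::complex_normed_vector)"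
  using scaleC_of_real[of 1 x] by simp

lemma scaleC_minus_left: "(- c) *\<^sub>C x = - (c *\<^sub>C (x::'x::complex_normed_vector))"
  using scaleC_add_left[of c "- c" x] scaleC_of_real[of 0 x]
  by (simp add: eq_neg_iff_add_eq_0 add.commute)

lemma scaleC_ii_ii: "\<i> *\<^sub>C \<i> *\<^sub>C x = - (x::'x::complex_normed_vector)"
  by (simp add: scaleC_scaleC scaleC_minus_left scaleC_one)

lemma linear_scaleC: "linear (\<lambda>x::'x::complex_normed_vector. c *\<^sub>C x)"
  by (rule linearI) (simp_all add: scaleC_add_right scaleR_eq_scaleC scaleC_scaleC mult.commute)

lemma linear_scaleC_scaleR: "linear (\<lambda>x::'x::complex_normed_vector. c *\<^sub>C t *\<^sub>R x)"
  by (rule linearI) (simp_all add: scaleR_eq_scaleC scaleC_scaleC scaleC_add_right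
      mult.commute mult.left_commute)

section \<open>The algebra-valued inner product\<close>

context hilbert_cstar_module
begin

lemma ip_add_left: "ip (x + y) z = ip x z + ip y z"
  by (metis ip_add_right ip_star star_add)

lemma ip_scaleC_left: "ip (c *\<^sub>C x) y = cnj c *\<^sub>C ip x y"
  by (metis ip_scaleC_right ip_star star_scaleC)

lemma linear_ip_right: "linear (ip x)"
  by (rule linearI) (simp_all add: ip_add_right scaleR_eq_scaleC ip_scaleC_right)

lemma linear_ip_left: "linear (\<lambda>x. ip x y)"
  by (rule linearI) (simp_all add: ip_add_left scaleR_eq_scaleC ip_scaleC_left)

lemmas ip_right_simps = linear_0[OF linear_ip_right] linear_diff[OF linear_ip_right]
  linear_scale[OF linear_ip_right] linear_neg[OF linear_ip_right]

lemmas ip_left_simps = linear_0[OF linear_ip_left] linear_diff[OF linear_ip_left]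
  linear_scale[OF linear_ip_left] linear_neg[OF linear_ip_left]

lemma ip_eqI: "(\<And>z. ip x z = ip y z) \<Longrightarrow> x = y"
  using ip_definite[of "x - y"] by (simp add: ip_left_simps)

lemma norm_ip_self: "norm (ip x x) = (norm x)\<^sup>2"
  by (simp add: norm_eq)

text \<open>
  Cauchy--Schwarz up to a constant: since the norm satisfies the triangle inequality by
  assumption, expanding \<open>\<langle>x + y, x + y\<rangle>\<close> suffices and no order on the algebra is needed.
\<close>

lemma norm_ip_le: "norm (ip x y) \<le> 6 * norm x * norm y"
proof -
  have re: "norm (ip u v + ip v u) \<le> 6" if "norm u = 1" "norm v = 1" for u v
  proof -
    have "ip u v + ip v u = ip (u + v) (u + v) - ip u u - ip v v"
      by (simp add: ip_add_left ip_add_right)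
    then have "norm (ip u v + ip v u) \<le> norm (ip (u + v) (u + v)) + norm (ip u u) + norm (ip v v)"
      by (metis (no_types, opaque_lifting) add_mono_thms_linordered_semiring(3) norm_triangle_ineq4
          order_trans)
    \<comment> \<open>Source of the constant 6: \<open>u + v\<close> has norm at most 2, and
      \<open>u\<close> and \<open>v\<close> are unit vectors.\<close>
    also have "\<dots> \<le> 2\<^sup>2 + 1 + 1"
      using norm_triangle_ineq[of u v] that
      by (intro add_mono) (simp_all add: norm_ip_self power_mono del: power_numeral)
    finally show ?thesis by simp
  qed
  have unit: "norm (ip u v) \<le> 6" if "norm u = 1" "norm v = 1" for u v
  proof -
    \<comment> \<open>Replacing \<open>v\<close> by \<open>\<i> *\<^sub>C v\<close> turns the bound
      on the sum of the two pairings into one on their difference; sum and difference add up to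
      twice \<open>ip u v\<close>.\<close>
    have i: "norm (\<i> *\<^sub>C v) = 1" using that by (simp add: norm_scaleC)
    have "ip u (\<i> *\<^sub>C v) + ip (\<i> *\<^sub>C v) u = \<i> *\<^sub>C ip u v - \<i> *\<^sub>C ip v u"
      by (simp add: ip_scaleC_left ip_scaleC_right scaleC_minus_left)
    then have "ip u (\<i> *\<^sub>C v) + ip (\<i> *\<^sub>C v) u = \<i> *\<^sub>C (ip u v - ip v u)"
      by (simp add: linear_diff[OF linear_scaleC])
    then have "norm (ip u v - ip v u) \<le> 6"
      using re[OF that(1) i] by (simp add: norm_scaleC)
    then have "norm ((ip u v + ip v u) + (ip u v - ip v u)) \<le> 6 + 6"
      using re[OF that] by (rule norm_triangle_mono[rotated])
    moreover have "(ip u v + ip v u) + (ip u v - ip v u) = 2 *\<^sub>R ip u v"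
      by (simp add: scaleR_2)
    ultimately show ?thesis by simp
  qed
  show ?thesis
  proof (cases "x = 0 \<or> y = 0")
    case True
    then show ?thesis by (auto simp: ip_left_simps ip_right_simps)
  next
    case False
    then have "norm (ip (x /\<^sub>R norm x) (y /\<^sub>R norm y)) \<le> 6" by (intro unit) auto
    then show ?thesis
      using False by (simp add: ip_left_simps ip_right_simps field_simps)
  qed
qed

lemma bounded_linear_ip_right: "bounded_linear (ip x)"
  using linear_ip_right norm_ip_le[of x]
  by (auto simp: bounded_linear_def bounded_linear_axioms_def mult.assoc mult.commute
      intro!: exI[of _ "6 * norm x"])

end

section \<open>Self-adjoint operators with closed range\<close>

locale selfadjoint_operator = hilbert_cstar_module rmul ip
  for rmul :: "'x::complex_banach \<Rightarrow> 'a::cstar_algebra \<Rightarrow> 'x"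
    and ip :: "'x \<Rightarrow> 'x \<Rightarrow> 'a" +
  fixes A :: "'x \<Rightarrow> 'x"
  assumes selfadjoint: "ip (A x) y = ip x (A y)"
    and bounded: "\<exists>K. \<forall>x. norm (A x) \<le> K * norm x"
begin

text \<open>Linearity comes from moving \<open>A\<close> to the right slot and testing against every
  vector.\<close>

lemma add: "A (x + y) = A x + A y"
  by (rule ip_eqI) (simp add: selfadjoint ip_add_left)

lemma scaleC: "A (c *\<^sub>C x) = c *\<^sub>C A x"
  by (rule ip_eqI) (simp add: selfadjoint ip_scaleC_left)

lemma linear: "linear A"
  by (rule linearI) (simp_all add: add scaleC scaleR_eq_scaleC)

lemma bounded_linear: "bounded_linear A"
  using linear bounded by (auto simp: bounded_linear_def bounded_linear_axioms_def mult.commute)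

text \<open>By self-adjointness the skew part of \<open>w\<close> is \<open>\<i> t\<close> times
  \<open>ip x x\<close>, of norm \<open>t * (norm x)\<^sup>2\<close>. Cauchy-Schwarz with constant 6
  then costs the factor 1/6.\<close>

lemma shifted_lower_bound:
  assumes "0 \<le> t"
  shows "t / 6 * norm x \<le> norm (A x + \<i> *\<^sub>C t *\<^sub>R x)"
proof (cases "x = 0")
  case False
  define w where "w = ip x (A x + \<i> *\<^sub>C t *\<^sub>R x)"
  have w: "w = ip x (A x) + \<i> *\<^sub>C t *\<^sub>R ip x x"
    by (simp add: w_def ip_add_right ip_scaleC_right ip_right_simps)
  have "star w = ip x (A x) - \<i> *\<^sub>C t *\<^sub>R ip x x"
    by (simp add: w star_add star_scaleC scaleR_eq_scaleC ip_star selfadjoint scaleC_minus_left)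
  then have "w - star w = 2 *\<^sub>R (\<i> *\<^sub>C t *\<^sub>R ip x x)"
    using w by (simp add: scaleR_2)
  then have "norm (w - star w) = 2 * t * (norm x)\<^sup>2"
    using assms by (simp add: norm_scaleC norm_ip_self)
  then have "t * (norm x)\<^sup>2 \<le> norm w"
    using norm_triangle_ineq4[of w "star w"] by (simp add: norm_star)
  also have "\<dots> \<le> 6 * norm x * norm (A x + \<i> *\<^sub>C t *\<^sub>R x)"
    unfolding w_def by (rule norm_ip_le)
  finally show ?thesis using False by (simp add: power2_eq_square field_simps)
qed simp

lemma linear_shifted: "linear (\<lambda>x. A x + \<i> *\<^sub>C t *\<^sub>R x)"
  by (rule linear_compose_add[OF linear linear_scaleC_scaleR])

text \<open>The lower bound \<open>t / 6\<close> allows steps from \<open>t\<close> down to \<open>11 t / 12\<close>.\<close>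

lemma surj_shifted: "\<exists>t0>0. \<forall>n. surj (\<lambda>x. A x + \<i> *\<^sub>C (t0 * (11/12) ^ n) *\<^sub>R x)"
proof -
  obtain K where K: "K > 0" "\<And>x. norm (A x) \<le> K * norm x"
    using bounded_linear.pos_bounded[OF bounded_linear] by (metis mult.commute)
  \<comment> \<open>Any value above \<open>K\<close> starts the induction: \<open>A\<close> is then
    a small perturbation of the invertible scalar \<open>\<i> t0\<close>.\<close>
  define t0 where "t0 = 2 * K"
  have t0: "t0 > 0" using K by (simp add: t0_def)
  have "surj (\<lambda>x. A x + \<i> *\<^sub>C (t0 * (11/12) ^ n) *\<^sub>R x)" for n
  proof (induction n)
    case 0
    have "linear (\<lambda>x::'x. \<i> *\<^sub>C t0 *\<^sub>R x)"
      by (rule linear_scaleC_scaleR)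
    moreover have "surj (\<lambda>x::'x. \<i> *\<^sub>C t0 *\<^sub>R x)"
    proof (rule surjI)
      show "\<i> *\<^sub>C t0 *\<^sub>R ((- \<i> / t0) *\<^sub>C x) = x" for x :: 'x
        using t0 by (simp add: scaleR_eq_scaleC scaleC_scaleC scaleC_one)
    qed
    moreover have "t0 * norm x \<le> norm (\<i> *\<^sub>C t0 *\<^sub>R x)" for x :: 'x
      using t0 by (simp add: norm_scaleC)
    ultimately have "surj (\<lambda>x. \<i> *\<^sub>C t0 *\<^sub>R x + A x)"
      using K t0 linear by (intro surj_linear_perturbation[where m = t0 and k = K])
        (auto simp: t0_def)
    then show ?case by (simp add: add.commute)
  next
    case (Suc n)
    define t where "t = t0 * (11/12) ^ n"
    have t: "t > 0" using t0 by (simp add: t_def)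
    have "linear (\<lambda>x::'x. \<i> *\<^sub>C (- t / 12) *\<^sub>R x)"
      by (rule linear_scaleC_scaleR)
    moreover have "norm (\<i> *\<^sub>C (- t / 12) *\<^sub>R x) \<le> t / 12 * norm x" for x :: 'x
      using t by (simp add: norm_scaleC)
    moreover have "t / 6 * norm x \<le> norm (A x + \<i> *\<^sub>C t *\<^sub>R x)" for x
      using t by (intro shifted_lower_bound) simp
    ultimately have "surj (\<lambda>x. (A x + \<i> *\<^sub>C t *\<^sub>R x) + \<i> *\<^sub>C (- t / 12) *\<^sub>R x)"
      using surj_linear_perturbation[OF linear_shifted Suc.IH[folded t_def],
          of "t / 6" "\<lambda>x. \<i> *\<^sub>C (- t / 12) *\<^sub>R x" "t / 12"] t by simp
    moreover have "\<i> *\<^sub>C t *\<^sub>R x + \<i> *\<^sub>C (- t / 12) *\<^sub>R x = \<i> *\<^sub>C (t * (11/12)) *\<^sub>R x" for x :: 'x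
      unfolding scaleC_add_right[symmetric] scaleR_left.add[symmetric] by (simp add: field_simps)
    ultimately have "surj (\<lambda>x. A x + \<i> *\<^sub>C (t * (11/12)) *\<^sub>R x)"
      by (simp only: add.assoc)
    moreover have "t0 * (11/12) ^ Suc n = t * (11/12)" by (simp add: t_def)
    ultimately show ?case by (simp only:)
  qed
  with t0 show ?thesis by blast
qed

text \<open>
  The functionals \<open>\<langle>r, \<cdot>\<rangle>\<close> with \<open>r \<in> R\<close>, \<open>\<parallel>A r\<parallel> \<le> 1\<close>, are pointwise bounded on \<open>R\<close>
  because \<open>\<langle>r, A y\<rangle> = \<langle>A r, y\<rangle>\<close>; a uniform bound, tested at \<open>r\<close> itself, bounds \<open>\<parallel>r\<parallel>\<close>.
\<close>

lemma lower_bound_on_closed_range: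
  assumes "closed (range A)"
  shows "\<exists>M. \<forall>r\<in>range A. norm r \<le> M * norm (A r)"
proof -
  define Z where "Z = {r\<in>range A. norm (A r) \<le> 1}"
  have sub: "subspace (range A)"
    using linear_subspace_image[OF linear subspace_UNIV] .
  have "\<exists>K. \<forall>z\<in>Z. \<forall>x\<in>range A. norm (ip z x) \<le> K * norm x"
  proof (rule uniform_boundedness_on_subspace[OF bounded_linear_ip_right sub assms])
    fix x assume "x \<in> range A"
    then obtain y where y: "x = A y" by blast
    have "norm (ip z x) \<le> 6 * norm y" if "z \<in> Z" for z
    proof -
      have "norm (ip z x) = norm (ip (A z) y)" by (simp add: y selfadjoint)
      also have "\<dots> \<le> 6 * norm (A z) * norm y" by (rule norm_ip_le)
      also have "\<dots> \<le> 6 * 1 * norm y"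
        using that by (intro mult_right_mono mult_left_mono) (auto simp: Z_def)
      finally show ?thesis by simp
    qed
    then show "\<exists>C. \<forall>z\<in>Z. norm (ip z x) \<le> C" by blast
  qed
  then obtain K where "\<And>z x. z \<in> Z \<Longrightarrow> x \<in> range A \<Longrightarrow> norm (ip z x) \<le> K * norm x" by blast
  then have "(norm z)\<^sup>2 \<le> K * norm z" if "z \<in> Z" for z
    using that by (metis (no_types, lifting) Z_def mem_Collect_eq norm_ip_self)
  then have Z: "norm z \<le> \<bar>K\<bar>" if "z \<in> Z" for z
    using that by (cases "z = 0") (force simp: power2_eq_square)+
  have "norm r \<le> (\<bar>K\<bar> + 1) * norm (A r)" if r: "r \<in> range A" for r
  proof (cases "A r = 0")
    case False
    have "norm (r /\<^sub>R norm (A r)) \<le> \<bar>K\<bar>"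
      using False r sub by (intro Z) (auto simp: Z_def linear_scale[OF linear] subspace_scale)
    then have "norm r \<le> \<bar>K\<bar> * norm (A r)" using False by (simp add: field_simps)
    then show ?thesis by (simp add: distrib_right add_increasing2)
  next
    case True
    \<comment> \<open>All multiples of \<open>r\<close> lie in \<open>Z\<close>; the one of norm
      \<open>\<bar>K\<bar> + 1\<close> would exceed the bound unless \<open>r = 0\<close>.\<close>
    have "norm (c *\<^sub>R r) \<le> \<bar>K\<bar>" for c
      using True r sub by (intro Z) (auto simp: Z_def linear_scale[OF linear] subspace_scale)
    from this[of "(\<bar>K\<bar> + 1) / norm r"] show ?thesis by (cases "r = 0") auto
  qed
  then show ?thesis by blast
qed

lemma range_subset_image_range:
  assumes cl: "closed (range A)"
  shows "A x \<in> A ` range A"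
proof -
  obtain M where M: "\<And>r. r \<in> range A \<Longrightarrow> norm r \<le> M * norm (A r)"
    using lower_bound_on_closed_range[OF cl] by blast
  have sub: "subspace (range A)"
    using linear_subspace_image[OF linear subspace_UNIV] .
  obtain t0 where t0: "t0 > 0" and surj: "\<And>n. surj (\<lambda>x. A x + \<i> *\<^sub>C (t0 * (11/12) ^ n) *\<^sub>R x)"
    using surj_shifted by blast
  define t where "t n = t0 * (11/12) ^ n" for n :: nat
  have t: "t n > 0" for n using t0 by (simp add: t_def)
  have "\<forall>n. \<exists>y. x = A y + \<i> *\<^sub>C t n *\<^sub>R y"
    using surj by (fastforce simp: surj_def t_def)
  then obtain y where y: "\<And>n. x = A (y n) + \<i> *\<^sub>C t n *\<^sub>R y n" by metis
  define r where "r n = A (y n)" for n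
  \<comment> \<open>The \<open>y n\<close> are controlled only after multiplication by
    \<open>t n\<close>, but that suffices for their images: 7 is 1 + 6.\<close>
  have nr: "norm (r n) \<le> 7 * norm x" for n
  proof -
    have "t n * norm (y n) \<le> 6 * norm x"
      using shifted_lower_bound[of "t n" "y n"] t[of n] y[of n] by simp
    moreover have "r n = x - \<i> *\<^sub>C t n *\<^sub>R y n" using y[of n] by (simp add: r_def algebra_simps)
    then have "norm (r n) \<le> norm x + t n * norm (y n)"
      using norm_triangle_ineq4[of x "\<i> *\<^sub>C t n *\<^sub>R y n"] t[of n] by (simp add: norm_scaleC)
    ultimately show ?thesis by simp
  qed
  \<comment> \<open>Applying \<open>A\<close> to the equation for \<open>x\<close> leaves the error
    \<open>\<i> t r\<close>, which vanishes in the limit because \<open>r n\<close> is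
    bounded.\<close>
  have Ar: "A x - A (r n) = \<i> *\<^sub>C t n *\<^sub>R r n" for n
  proof -
    have "A x = A (A (y n)) + A (\<i> *\<^sub>C t n *\<^sub>R y n)" by (metis y add)
    then show ?thesis by (simp add: r_def scaleC linear_scale[OF linear])
  qed
  have "(\<lambda>n. A x - A (r n)) \<longlonglongrightarrow> 0"
  proof (rule Lim_null_comparison)
    show "\<forall>\<^sub>F n in sequentially. norm (A x - A (r n)) \<le> t n * (7 * norm x)"
      using nr t by (auto simp: Ar norm_scaleC less_imp_le)
    have "t \<longlonglongrightarrow> t0 * 0"
      unfolding t_def by (intro tendsto_mult tendsto_const LIMSEQ_realpow_zero) auto
    then show "(\<lambda>n. t n * (7 * norm x)) \<longlonglongrightarrow> 0" by (auto intro: tendsto_mult_left_zero)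
  qed
  from tendsto_diff[OF tendsto_const[of "A x"] this] have lim: "(\<lambda>n. A (r n)) \<longlonglongrightarrow> A x" by simp
  \<comment> \<open>A map bounded below on a complete subspace has complete image there; adding 1 to
    \<open>\<bar>M\<bar>\<close> keeps the constant positive.\<close>
  have "complete (A ` range A)"
  proof (rule complete_isometric_image)
    show "0 < inverse (\<bar>M\<bar> + 1)" by simp
    show "subspace (range A)" by (rule sub)
    show "bounded_linear A" by (rule bounded_linear)
    show "\<forall>x\<in>range A. inverse (\<bar>M\<bar> + 1) * norm x \<le> norm (A x)"
    proof
      fix r assume "r \<in> range A"
      then have "norm r \<le> (\<bar>M\<bar> + 1) * norm (A r)"
        by (rule order_trans[OF M mult_right_mono]) auto
      then show "inverse (\<bar>M\<bar> + 1) * norm r \<le> norm (A r)" by (simp add: field_simps)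
    qed
    show "complete (range A)" using cl by (simp add: complete_eq_closed)
  qed
  then have "closed (A ` range A)" by (rule complete_imp_closed)
  moreover have "A (r n) \<in> A ` range A" for n by (auto simp: r_def)
  ultimately show ?thesis using lim by (rule closed_sequentially)
qed

text \<open>Split \<open>u\<close> into \<open>r\<close> in the range and \<open>k\<close> in the
  kernel. Both \<open>u\<close> and \<open>r\<close> are orthogonal to the kernel, hence so is
  \<open>k\<close>, which is therefore orthogonal to itself.\<close>

lemma orthogonal_kernel_subset_range:
  assumes "closed (range A)" and orth: "\<And>k. A k = 0 \<Longrightarrow> ip u k = 0"
  shows "u \<in> range A"
proof -
  obtain r where r: "r \<in> range A" "A u = A r"
    using range_subset_image_range[OF assms(1)] by blast
  define k where "k = u - r"
  have Ak: "A k = 0" using r by (simp add: k_def linear_diff[OF linear])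
  obtain v where "r = A v" using r by blast
  then have "ip r k = 0" using Ak by (simp add: selfadjoint ip_right_simps)
  then have "ip k k = 0" using orth[OF Ak] by (simp add: k_def ip_left_simps)
  then have "k = 0" by (rule ip_definite)
  then show ?thesis using r by (simp add: k_def)
qed

end

section \<open>Positive forms and spline interpolation\<close>

text \<open>Polarisation with \<open>y\<close> and with \<open>\<i> y\<close>.\<close>

lemma hermitian_of_positive:
  fixes B :: "'x::complex_banach \<Rightarrow> 'x \<Rightarrow> 'a::cstar_algebra"
  assumes B: "bounded_sesquilinear_form rmul B" and Y: "submodule rmul Y"
    and pos: "\<And>y. y \<in> Y \<Longrightarrow> positive_element (B y y)"
    and xy: "x \<in> Y" "y \<in> Y"
  shows "star (B x y) = B y x"
proof -
  have add: "B (u + v) w = B u w + B v w" "B w (u + v) = B w u + B w v"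
    and scale: "B (c *\<^sub>C u) v = cnj c *\<^sub>C B u v" "B u (c *\<^sub>C v) = c *\<^sub>C B u v" for u v w c
    using B by (auto simp: bounded_sesquilinear_form_def)
  have sa: "star (B y y) = B y y" if "y \<in> Y" for y
    using star_positive_element pos[OF that] .
  have re: "star (B u v) + star (B v u) = B u v + B v u" if "u \<in> Y" "v \<in> Y" for u v
  proof -
    have "u + v \<in> Y" using Y that by (simp add: submodule_def)
    from sa[OF this] show ?thesis using that
      by (simp add: add star_add sa algebra_simps)
  qed
  define p where "p = star (B x y)"
  define q where "q = star (B y x)"
  have 1: "p + q = B x y + B y x" using re[OF xy] by (simp add: p_def q_def)
  have "\<i> *\<^sub>C y \<in> Y" using Y xy by (simp add: submodule_def)
  from re[OF xy(1) this] have "\<i> *\<^sub>C (q - p) = \<i> *\<^sub>C (B x y - B y x)"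
    by (simp add: scale star_scaleC star_minus scaleC_minus_left p_def q_def
        linear_diff[OF linear_scaleC])
  then have "\<i> *\<^sub>C \<i> *\<^sub>C (q - p) = \<i> *\<^sub>C \<i> *\<^sub>C (B x y - B y x)" by simp
  then have 2: "q - p = B x y - B y x" by (simp add: scaleC_ii_ii algebra_simps)
  from 1 2 have "(p + q) - (q - p) = (B x y + B y x) - (B x y - B y x)" by simp
  then have "2 *\<^sub>R p = 2 *\<^sub>R B y x" by (simp add: scaleR_2)
  then show ?thesis by (simp add: p_def)
qed

theorem theorem3p10:
  fixes rmul :: "'x::complex_banach \<Rightarrow> 'a::cstar_algebra \<Rightarrow> 'x"
    and ip :: "'x \<Rightarrow> 'x \<Rightarrow> 'a"
    and Y :: "'x set"
    and P T :: "'x \<Rightarrow> 'x"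
    and B :: "'x \<Rightarrow> 'x \<Rightarrow> 'a"
  assumes "hilbert_cstar_module rmul ip"
    and "self_dual rmul ip"
    and "orthogonally_complemented rmul ip Y"
    and "orthogonal_projection_onto ip Y P"
    and "bounded_sesquilinear_form rmul B"
    and "\<And>y. y \<in> Y \<Longrightarrow> positive_element (B y y)"
    and "adjointable ip T"
    and "\<And>x y. B x y = ip (T x) y"
  shows "(spline_interpolation_solvable B Y \<longrightarrow> (\<forall>x. \<forall>z\<in>form_kernel B Y. B x z = 0)) \<and>
         (closed (P ` T ` Y) \<longrightarrow>
            (\<forall>x. \<forall>z\<in>form_kernel B Y. B x z = 0) \<longrightarrow> spline_interpolation_solvable B Y)"
proof -
  interpret hilbert_cstar_module rmul ip by fact
  have Y: "submodule rmul Y" using assms(3) by (simp add: orthogonally_complemented_def)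
  have add_Y: "u + v \<in> Y" if "u \<in> Y" "v \<in> Y" for u v
    using Y that by (simp add: submodule_def)
  have neg_Y: "- v \<in> Y" if "v \<in> Y" for v
  proof -
    have "complex_of_real (- 1) *\<^sub>C v \<in> Y" using Y that by (simp only: submodule_def)
    then show ?thesis by (simp only: scaleC_of_real) simp
  qed
  have B_add: "B (u + v) w = B u w + B v w" for u v w
    using assms(5) by (simp add: bounded_sesquilinear_form_def)
  have herm: "star (B u v) = B v u" if "u \<in> Y" "v \<in> Y" for u v
    using hermitian_of_positive[OF assms(5) Y assms(6) that] .
  have PY: "P x \<in> Y" for x
    using assms(4) by (simp add: orthogonal_projection_onto_def)
  \<comment> \<open>Pairing with \<open>Y\<close> does not see the component
    \<open>x - P x\<close>.\<close>
  have ipP: "ip (P x) y = ip x y" if "y \<in> Y" for x y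
  proof -
    have "ip (x - P x) y = 0"
      using assms(4) that by (simp add: orthogonal_projection_onto_def orthogonal_complement_def)
    then show ?thesis by (simp add: ip_left_simps)
  qed
  have ipP': "ip y (P x) = ip y x" if "y \<in> Y" for x y
    using ipP[OF that] by (metis ip_star)
  have eq_Y: "u = v" if "u \<in> Y" "v \<in> Y" "\<And>y. y \<in> Y \<Longrightarrow> ip u y = ip v y" for u v
  proof -
    have "u - v \<in> Y" using add_Y[OF that(1) neg_Y[OF that(2)]] by simp
    then have "ip (u - v) (u - v) = 0" using that(3) by (simp add: ip_left_simps)
    then show ?thesis using ip_definite by force
  qed
  have P_Y: "P y = y" if "y \<in> Y" for y
    using eq_Y[OF PY that] ipP by simp
  have P_0: "P x = 0 \<longleftrightarrow> (\<forall>y\<in>Y. ip x y = 0)" for x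
  proof
    have "0 \<in> Y" using Y by (simp add: submodule_def)
    then show "P x = 0" if "\<forall>y\<in>Y. ip x y = 0"
      using that by (intro eq_Y PY) (simp_all add: ipP ip_left_simps)
    show "\<forall>y\<in>Y. ip x y = 0" if "P x = 0"
      using ipP[of _ x] that by (simp add: ip_left_simps)
  qed

  \<comment> \<open>A solution \<open>x + y\<close> reduces \<open>B x z\<close> to
    \<open>- B y z\<close>; Hermitian symmetry moves \<open>z\<close> to the left slot, where it
    annihilates \<open>Y\<close>.\<close>
  have necessary: "B x z = 0"
    if solv: "spline_interpolation_solvable B Y" and z: "z \<in> form_kernel B Y" for x z
  proof -
    obtain y where y: "y \<in> Y" "\<forall>w\<in>Y. B (x + y) w = 0"
      using solv unfolding spline_interpolation_solvable_def by blast
    have zY: "z \<in> Y" and "B z y = 0" using z y by (auto simp: form_kernel_def)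
    then have "B y z = 0" using herm[OF zY y(1)] by (simp add: star_zero)
    then show ?thesis using y zY B_add[of x y z] by simp
  qed

  have sufficient: "spline_interpolation_solvable B Y"
    if cl: "closed (P ` T ` Y)" and star: "\<forall>x. \<forall>z\<in>form_kernel B Y. B x z = 0"
  proof -
    \<comment> \<open>The inner \<open>P\<close> extends the compression of \<open>T\<close> from
      \<open>Y\<close> to an operator on the whole module with the same range.\<close>
    define A where "A x = P (T (P x))" for x
    obtain K where K: "\<And>x y. norm (B x y) \<le> K * norm x * norm y"
      using assms(5) by (auto simp: bounded_sesquilinear_form_def)
    have P_bound: "norm (P x) \<le> 6 * norm x" for x
    proof (cases "P x = 0")
      case False
      have "(norm (P x))\<^sup>2 = norm (ip x (P x))" by (metis PY ipP norm_ip_self)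
      also have "\<dots> \<le> 6 * norm x * norm (P x)" by (rule norm_ip_le)
      finally show ?thesis using False by (simp add: power2_eq_square)
    qed simp
    \<comment> \<open>Test the bound on \<open>B\<close> at the pair \<open>x\<close>,
      \<open>T x\<close>.\<close>
    have T_bound: "norm (T x) \<le> \<bar>K\<bar> * norm x" for x
    proof (cases "T x = 0")
      case False
      have "(norm (T x))\<^sup>2 = norm (B x (T x))" by (simp add: assms(8) norm_ip_self)
      also have "\<dots> \<le> K * norm x * norm (T x)" by (rule K)
      finally have "norm (T x) \<le> K * norm x" using False by (simp add: power2_eq_square)
      also have "\<dots> \<le> \<bar>K\<bar> * norm x" by (intro mult_right_mono) auto
      finally show ?thesis .
    qed simp
    \<comment> \<open>This turns Hermitian symmetry of \<open>B\<close> on \<open>Y\<close> into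
      self-adjointness of \<open>A\<close>.\<close>
    have ipA: "ip (A x) y = B (P x) (P y)" for x y
      by (metis A_def PY assms(8) ipP ipP')
    interpret A: selfadjoint_operator rmul ip A
    proof
      show "ip (A x) y = ip x (A y)" for x y
        by (metis PY herm ipA ip_star)
      have "norm (A x) \<le> 6 * (\<bar>K\<bar> * (6 * norm x))" for x
      proof -
        have "norm (A x) \<le> 6 * norm (T (P x))" unfolding A_def by (rule P_bound)
        also have "\<dots> \<le> 6 * (\<bar>K\<bar> * norm (P x))" using T_bound[of "P x"] by simp
        also have "\<dots> \<le> 6 * (\<bar>K\<bar> * (6 * norm x))"
          using P_bound[of x] by (intro mult_left_mono) auto
        finally show ?thesis .
      qed
      then show "\<exists>K. \<forall>x. norm (A x) \<le> K * norm x" by (metis mult.assoc)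
    qed
    have "range P = Y" using PY P_Y by (metis image_subset_iff rangeI subsetI subset_antisym)
    then have range_A: "range A = P ` T ` Y" by (auto simp: A_def)
    have "\<exists>s\<in>{x + y |y. y \<in> Y}. \<forall>y\<in>Y. B s y = 0" for x
    proof -
      have "P (T x) \<in> range A"
      proof (rule A.orthogonal_kernel_subset_range)
        show "closed (range A)" using cl range_A by simp
        fix k assume "A k = 0"
        \<comment> \<open>\<open>A k = 0\<close> says that \<open>T (P k)\<close> is orthogonal to
          \<open>Y\<close>.\<close>
        then have "P k \<in> form_kernel B Y"
          using PY by (auto simp: form_kernel_def A_def P_0 assms(8))
        then have "B x (P k) = 0" using star by blast
        then show "ip (P (T x)) k = 0" by (metis PY assms(8) ipP ipP')
      qed
      then obtain v where v: "P (T x) = A v" by blast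
      \<comment> \<open>On \<open>Y\<close> the forms \<open>B x\<close> and \<open>B (P v)\<close>
        agree, so subtracting \<open>P v\<close> from \<open>x\<close> gives the spline.\<close>
      define y where "y = - P v"
      have "y \<in> Y" using neg_Y PY by (simp add: y_def)
      moreover have "B (x + y) w = 0" if w: "w \<in> Y" for w
      proof -
        have "B x w = B (P v) w" using v w by (metis A_def assms(8) ipP)
        moreover have "B x w = B (x + y) w + B (P v) w"
          using B_add[of "x + y" "P v" w] by (simp add: y_def)
        ultimately show ?thesis by simp
      qed
      ultimately show ?thesis by blast
    qed
    then show ?thesis by (simp add: spline_interpolation_solvable_def)
  qed
  from necessary sufficient show ?thesis by blast
qed

end
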